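(* Let $k\geq5$ be odd and let $d$ be an integer with $d\geq\frac{3^{k-1}}{k-1}+1$. Then $BC_{d,k}\geq 2(k-1)\left(\lfloor\frac{d}{2}\rfloor\right)^{k-1}$.
   Context: A Cayley digraph $Cay(\Gamma,X)$ of a group $\Gamma$ with respect to a generating set $X$ not containing the identity has vertex set $\Gamma$ and an arc from $u$ to $v$ iff $ux=v$ for some $x\in X$; its degree is $|X|$. It is bipartite if its vertex set can be partitioned into two parts such that every arc joins vertices in different parts. $BC_{d,k}$ denotes the largest number of vertices of a bipartite Cayley digraph of degree $d$ and diameter $k$ (diameter = maximum directed distance). *)

theory Defs
  imports
    "HOL-Algebra.Generated_Groups"
    "Graph_Theory.Pair_Digraph"
    "Graph_Theory.Shortest_Path"
begin

definition Cayley_digraph :: "('a, 'b) monoid_scheme \<Rightarrow> 'a set \<Rightarrow> 'a pair_pre_digraph" where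
  "Cayley_digraph G X =
    \<lparr> pverts = carrier G,
      parcs = {(u, v). u \<in> carrier G \<and> v \<in> carrier G \<and> (\<exists>x\<in>X. u \<otimes>\<^bsub>G\<^esub> x = v)} \<rparr>"

definition bipartite_digraph :: "'a pair_pre_digraph \<Rightarrow> bool" where
  "bipartite_digraph D \<longleftrightarrow>
    (\<exists>A B. A \<union> B = pverts D \<and> A \<inter> B = {} \<and>
      (\<forall>(u, v)\<in>parcs D. u \<in> A \<and> v \<in> B \<or> u \<in> B \<and> v \<in> A))"

text \<open>With unit weights, the cost of a walk is its length, so the shortest-path cost is the
  directed distance (infinite if there is no walk).\<close>

definition digraph_dist :: "'a pair_pre_digraph \<Rightarrow> 'a \<Rightarrow> 'a \<Rightarrow> ereal" where
  "digraph_dist D u v = wf_digraph.\<mu> (with_proj D) (\<lambda>_. 1) u v"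

definition digraph_diameter :: "'a pair_pre_digraph \<Rightarrow> ereal" where
  "digraph_diameter D = (SUP u\<in>pverts D. SUP v\<in>pverts D. digraph_dist D u v)"

text \<open>Every finite group is isomorphic to one whose carrier is a set of natural numbers, so
  ranging over the type \<^typ>\<open>nat monoid\<close> loses no orders.  Finiteness of the group is no
  restriction: a digraph of finite degree and finite diameter is finite.  Likewise, by the Moore
  bound this set of orders is finite for all \<open>d\<close> and \<open>k\<close>.\<close>

definition bipartite_Cayley_orders :: "nat \<Rightarrow> nat \<Rightarrow> nat set" where
  "bipartite_Cayley_orders d k =
    {card (carrier G) | (G :: nat monoid) X.
      group G \<and> finite (carrier G) \<and>
      X \<subseteq> carrier G \<and> generate G X = carrier G \<and> \<one>\<^bsub>G\<^esub> \<notin> X \<and>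
      card X = d \<and>
      bipartite_digraph (Cayley_digraph G X) \<and>
      digraph_diameter (Cayley_digraph G X) = ereal (real k)}"

text \<open>The maximum is unspecified if no such digraph exists.\<close>

definition BC :: "nat \<Rightarrow> nat \<Rightarrow> nat" where
  "BC d k = Max (bipartite_Cayley_orders d k)"

end

(*
  Let m = k - 1 (even) and q = d div 2. In (Z_q wr Z_m) x Z_2 take as generators the elements
  (h at coordinate 0, shift s) with odd Z_2-part, for h in Z_q and s in {1, 2}, padded to d elements
  by arbitrary odd ones. A word of length m whose partial shift sums are distinct mod m writes every
  lamp exactly once, so it can produce any lamp configuration; its final position is the total shift.
  Such a shift sequence exists for each final position j: with s = j div 2, run through the even
  residues up to 2s, then through all residues up to m - 1, then through the odd residues below 2s;
  the last shift is free and decides the parity of j. So every even element is a word of length m and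
  every odd element one of length k. An odd element at distance less than k has distance less than m
  by parity, and counting words shows that there are more odd elements than that.
*)
theory Submission
  imports Defs "HOL-Algebra.Weak_Morphisms"
begin

section \<open>Distances in Cayley digraphs\<close>

lemma Cayley_digraph_simps [simp]:
  "pverts (Cayley_digraph G X) = carrier G"
  "parcs (Cayley_digraph G X) =
    {(u, v). u \<in> carrier G \<and> v \<in> carrier G \<and> (\<exists>x\<in>X. u \<otimes>\<^bsub>G\<^esub> x = v)}"
  by (simp_all add: Cayley_digraph_def)

text \<open>Length is exact rather than bounded, because the later parity argument must separate
  words of length \<open>m\<close> from words of length \<open>m + 1\<close>. Factors are appended
  on the right, in the direction of the arcs.\<close>

primrec words :: "('a, 'b) monoid_scheme \<Rightarrow> 'a set \<Rightarrow> nat \<Rightarrow> 'a set" where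
  "words G X 0 = {\<one>\<^bsub>G\<^esub>}"
| "words G X (Suc n) = words G X n <#>\<^bsub>G\<^esub> X"

context group
begin

lemma words_closed: "X \<subseteq> carrier G \<Longrightarrow> words G X n \<subseteq> carrier G"
  by (induction n) (simp_all add: set_mult_closed)

lemma words_subset_generate: "words G X n \<subseteq> generate G X"
  by (induction n) (auto simp: set_mult_def intro: generate.intros)

lemma finite_words: "finite X \<Longrightarrow> finite (words G X n)"
  by (induction n) (auto simp: set_mult_def)

lemma card_words_le:
  assumes "finite X"
  shows "card (words G X n) \<le> card X ^ n"
proof (induction n)
  case (Suc n)
  have "words G X n <#> X = (\<lambda>(w, x). w \<otimes> x) ` (words G X n \<times> X)"
    by (auto simp: set_mult_def)
  then have "card (words G X (Suc n)) \<le> card (words G X n \<times> X)"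
    using card_image_le[OF finite_cartesian_product[OF finite_words[OF assms] assms]] by simp
  also have "\<dots> \<le> card X ^ Suc n"
    using Suc by (simp add: card_cartesian_product mult.commute)
  finally show ?case .
qed simp

lemma card_UN_words_le:
  assumes "finite X"
  shows "card (\<Union>i<n. words G X i) \<le> (\<Sum>i<n. card X ^ i)"
  by (rule order.trans[OF card_UN_le]) (auto intro: sum_mono card_words_le[OF assms])

text \<open>The recursion of \<open>words\<close> only appends. Prepending is what turns a word for
  \<open>inv x \<otimes> g\<close> into a longer one for \<open>g\<close>.\<close>

lemma words_Suc_left:
  assumes "X \<subseteq> carrier G" "x \<in> X" "w \<in> words G X n"
  shows "x \<otimes> w \<in> words G X (Suc n)"
  using assms(3)
proof (induction n arbitrary: w)
  case 0
  then show ?case using assms by (force simp: set_mult_def)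
next
  case (Suc n)
  then obtain v y where vy: "v \<in> words G X n" "y \<in> X" "w = v \<otimes> y"
    by (auto simp: set_mult_def)
  have "x \<otimes> w = (x \<otimes> v) \<otimes> y"
    using vy assms words_closed[OF assms(1), of n] by (simp add: m_assoc subset_iff)
  then show ?case using Suc.IH[OF vy(1)] vy(2) by (subst words.simps(2)) (unfold set_mult_def, blast)
qed

section \<open>Walks, distances and diameter in terms of words\<close>

lemma wf_Cayley_digraph: "wf_digraph (with_proj (Cayley_digraph G X))"
  by unfold_locales auto

text \<open>The labels read along a walk from \<open>u\<close> multiply up to a word
  \<open>w\<close>, and the walk ends at \<open>u \<otimes> w\<close>. The induction splits off the
  last arc, matching the last factor of the word.\<close>

lemma Cayley_awalk_iff:
  assumes X: "X \<subseteq> carrier G" and u: "u \<in> carrier G"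
  shows "(\<exists>p. pre_digraph.awalk (with_proj (Cayley_digraph G X)) u p v \<and> length p = n)
    \<longleftrightarrow> v \<in> u <# words G X n"
proof -
  interpret C: wf_digraph "with_proj (Cayley_digraph G X)" by (rule wf_Cayley_digraph)
  show ?thesis
  proof (induction n arbitrary: v)
    case 0
    then show ?case using u by (auto simp: C.awalk_Nil_iff l_coset_def)
  next
    case (Suc n)
    show ?case
    proof
      assume "\<exists>p. C.awalk u p v \<and> length p = Suc n"
      then obtain p e where p: "C.awalk u (p @ [e]) v" "length p = n"
        by (metis length_Suc_conv_rev)
      then obtain w where w: "C.awalk u p w" "e \<in> parcs (Cayley_digraph G X)" "w = fst e" "v = snd e"
        by (auto simp: C.awalk_Cons_iff C.awalk_Nil_iff)
      then have "w \<in> u <# words G X n" using Suc p(2) by blast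
      then obtain z where z: "z \<in> words G X n" "w = u \<otimes> z" by (auto simp: l_coset_def)
      from w obtain x where x: "x \<in> X" "v = w \<otimes> x"
        by auto
      have "v = u \<otimes> (z \<otimes> x)"
        using z x u X words_closed[OF X, of n] by (simp add: m_assoc subset_iff)
      then show "v \<in> u <# words G X (Suc n)" using z x by (auto simp: l_coset_def set_mult_def)
    next
      assume "v \<in> u <# words G X (Suc n)"
      then obtain z x where z: "z \<in> words G X n" "x \<in> X" "v = u \<otimes> (z \<otimes> x)"
        by (auto simp: l_coset_def set_mult_def)
      have zc: "z \<in> carrier G" "x \<in> carrier G" using z X words_closed[OF X, of n] by auto
      have "u \<otimes> z \<in> u <# words G X n" using z by (auto simp: l_coset_def)
      then obtain p where p: "C.awalk u p (u \<otimes> z)" "length p = n" using Suc by blast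
      have "C.awalk (u \<otimes> z) [(u \<otimes> z, v)] v"
        using z zc u by (auto simp: C.awalk_Cons_iff C.awalk_Nil_iff m_assoc[symmetric])
      then have "C.awalk u (p @ [(u \<otimes> z, v)]) v" using p by auto
      then show "\<exists>p. C.awalk u p v \<and> length p = Suc n" using p(2)
        by (metis length_append_singleton)
    qed
  qed
qed

lemma Cayley_dist_le_iff:
  assumes X: "X \<subseteq> carrier G" and u: "u \<in> carrier G"
  shows "digraph_dist (Cayley_digraph G X) u v \<le> ereal (real k)
    \<longleftrightarrow> (\<exists>n\<le>k. v \<in> u <# words G X n)"
proof -
  interpret C: wf_digraph "with_proj (Cayley_digraph G X)" by (rule wf_Cayley_digraph)
  have cost: "C.awalk_cost (\<lambda>_. 1) p = real (length p)" for p
    by (induction p) auto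
  have dist: "digraph_dist (Cayley_digraph G X) u v = (INF p\<in>{p. C.awalk u p v}. ereal (real (length p)))"
    by (simp add: digraph_dist_def C.\<mu>_def cost)
  show ?thesis
  proof
    assume "digraph_dist (Cayley_digraph G X) u v \<le> ereal (real k)"
    \<comment> \<open>A non-strict bound on an infimum yields no walk directly. The strict bound
      \<open>Suc k\<close> does, and its length, being an integer, is at most
      \<open>k\<close>.\<close>
    also have "\<dots> < ereal (real (Suc k))" by simp
    finally obtain p where "C.awalk u p v" "ereal (real (length p)) < ereal (real (Suc k))"
      unfolding dist INF_less_iff by auto
    then show "\<exists>n\<le>k. v \<in> u <# words G X n"
      using Cayley_awalk_iff[OF X u, of v "length p"] by (intro exI[of _ "length p"]) auto
  next
    assume "\<exists>n\<le>k. v \<in> u <# words G X n"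
    then obtain p where "C.awalk u p v" "length p \<le> k"
      using Cayley_awalk_iff[OF X u, of v] by metis
    then show "digraph_dist (Cayley_digraph G X) u v \<le> ereal (real k)"
      unfolding dist by (auto intro: INF_lower2)
  qed
qed

text \<open>Left translations are automorphisms of the digraph, so the distance from
  \<open>u\<close> to \<open>v\<close> is that from the identity to
  \<open>inv u \<otimes> v\<close>, and only distances from the identity matter.\<close>

lemma Cayley_diameter_le_iff:
  assumes X: "X \<subseteq> carrier G"
  shows "digraph_diameter (Cayley_digraph G X) \<le> ereal (real k)
    \<longleftrightarrow> carrier G \<subseteq> (\<Union>n\<le>k. words G X n)"
proof -
  have "v \<in> u <# words G X n \<longleftrightarrow> inv u \<otimes> v \<in> words G X n"
    if "u \<in> carrier G" "v \<in> carrier G" for u v n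
  proof
    assume "v \<in> u <# words G X n"
    then show "inv u \<otimes> v \<in> words G X n"
      using that words_closed[OF X, of n]
      by (auto simp: l_coset_def subset_iff m_assoc[symmetric])
  next
    assume "inv u \<otimes> v \<in> words G X n"
    moreover have "v = u \<otimes> (inv u \<otimes> v)" using that by (simp add: m_assoc[symmetric])
    ultimately show "v \<in> u <# words G X n" by (auto simp: l_coset_def)
  qed
  then have "digraph_diameter (Cayley_digraph G X) \<le> ereal (real k)
    \<longleftrightarrow> (\<forall>u\<in>carrier G. \<forall>v\<in>carrier G. \<exists>n\<le>k. inv u \<otimes> v \<in> words G X n)"
    unfolding digraph_diameter_def SUP_le_iff
    by (simp add: Cayley_dist_le_iff[OF X])
  also have "\<dots> \<longleftrightarrow> (\<forall>g\<in>carrier G. \<exists>n\<le>k. g \<in> words G X n)"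
    by (metis inv_closed m_closed inv_one l_one one_closed)
  finally show ?thesis by auto
qed

text \<open>Together with the upper bound this pins the diameter down: an element missed by all
  words of length at most \<open>k\<close> needs a walk of integer length at least
  \<open>k + 1\<close>, or has no walk at all.\<close>

lemma Cayley_diameter_ge:
  assumes X: "X \<subseteq> carrier G" and "\<not> carrier G \<subseteq> (\<Union>n\<le>k. words G X n)"
  shows "ereal (real (k + 1)) \<le> digraph_diameter (Cayley_digraph G X)"
proof -
  interpret C: wf_digraph "with_proj (Cayley_digraph G X)" by (rule wf_Cayley_digraph)
  obtain g where g: "g \<in> carrier G" "\<And>n. n \<le> k \<Longrightarrow> g \<notin> words G X n"
    using assms(2) by blast
  have "ereal (real (k + 1)) \<le> digraph_dist (Cayley_digraph G X) \<one> g"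
    unfolding digraph_dist_def C.\<mu>_def
  proof (rule INF_greatest)
    fix p assume "p \<in> {p. C.awalk \<one> p g}"
    then have "g \<in> \<one> <# words G X (length p)"
      using Cayley_awalk_iff[OF X one_closed] by blast
    then have "g \<in> words G X (length p)"
      using lcos_mult_one[OF words_closed[OF X]] by simp
    then have "\<not> length p \<le> k" using g(2) by blast
    moreover have "C.awalk_cost (\<lambda>_. 1) p = real (length p)" by (induction p) auto
    ultimately show "ereal (real (k + 1)) \<le> ereal (C.awalk_cost (\<lambda>_. 1) p)" by simp
  qed
  then show ?thesis
    unfolding digraph_diameter_def using g(1)
    by (intro SUP_upper2[of \<one>] SUP_upper2[of g]) auto
qed

end

text \<open>Needed to carry the digraph over to an isomorphic group on natural numbers.\<close>

lemma words_hom_image: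
  assumes "group G" "group H" "h \<in> hom G H" "X \<subseteq> carrier G"
  shows "words H (h ` X) n = h ` words G X n"
proof (induction n)
  case 0
  then show ?case using assms by (simp add: hom_one)
next
  case (Suc n)
  interpret group G by fact
  have "h ` (words G X n <#>\<^bsub>G\<^esub> X) = h ` words G X n <#>\<^bsub>H\<^esub> h ` X"
    unfolding set_mult_def using words_closed[OF assms(4)] assms(4) hom_mult[OF assms(3)]
    by (fastforce simp: subset_iff image_iff)
  then show ?case using Suc by simp
qed

text \<open>Moore bound: words of length at most \<open>k\<close> in \<open>d\<close> generators
  cover the group. Finiteness makes \<open>Max\<close> in \<open>BC\<close> an upper bound of every
  realised order.\<close>

lemma finite_bipartite_Cayley_orders: "finite (bipartite_Cayley_orders d k)"
proof (rule finite_subset)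
  show "bipartite_Cayley_orders d k \<subseteq> {..\<Sum>i<Suc k. d ^ i}"
  proof
    fix N assume "N \<in> bipartite_Cayley_orders d k"
    then obtain G :: "nat monoid" and X where G: "group G" "finite (carrier G)" "X \<subseteq> carrier G"
      and N: "N = card (carrier G)" "card X = d"
      and diam: "digraph_diameter (Cayley_digraph G X) \<le> ereal (real k)"
      unfolding bipartite_Cayley_orders_def by auto
    interpret group G by fact
    have fin: "finite X" using G finite_subset by blast
    have "carrier G \<subseteq> (\<Union>n<Suc k. words G X n)"
      using Cayley_diameter_le_iff[OF G(3)] diam by (auto simp: lessThan_Suc_atMost)
    then have "N \<le> card (\<Union>n<Suc k. words G X n)"
      unfolding N by (intro card_mono) (auto intro: finite_words[OF fin])
    also have "\<dots> \<le> (\<Sum>i<Suc k. d ^ i)" using card_UN_words_le[OF fin] N(2) by blast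
    finally show "N \<in> {..\<Sum>i<Suc k. d ^ i}" by simp
  qed
qed simp

section \<open>A criterion for realising an order\<close>

text \<open>\<open>P\<close> is the odd class: with \<open>one\<close>, \<open>flip\<close> and
  \<open>X\<close> nonempty, its complement is a subgroup of index two. Even elements are reached in
  exactly \<open>m\<close> steps by \<open>cover\<close>, odd ones in one step more. By
  \<open>big\<close>, words shorter than \<open>m\<close> are too few to reach all of
  \<open>P\<close>, so the diameter is exactly \<open>m + 1\<close>.\<close>

lemma bipartite_Cayley_ordersI:
  fixes G :: "('a, 'b) monoid_scheme" (structure)
  assumes "group G" and fin: "finite (carrier G)" and "X \<subseteq> P" and "P \<subseteq> carrier G"
    and one: "\<one>\<^bsub>G\<^esub> \<notin> P"
    and flip: "\<And>g x. g \<in> carrier G \<Longrightarrow> x \<in> P \<Longrightarrow> g \<otimes>\<^bsub>G\<^esub> x \<in> P \<longleftrightarrow> g \<notin> P"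
    and "X \<noteq> {}" and "even m"
    and cover: "carrier G - P \<subseteq> words G X m"
    and big: "(\<Sum>i<m. card X ^ i) < card P"
  shows "card (carrier G) \<in> bipartite_Cayley_orders (card X) (m + 1)"
proof -
  interpret group G by fact
  have X: "X \<subseteq> carrier G" using assms by blast
  have finX: "finite X" using X fin finite_subset by blast
  have parity: "w \<in> P \<longleftrightarrow> odd n" if "w \<in> words G X n" for w n
    using that
  proof (induction n arbitrary: w)
    case 0
    then show ?case using one by simp
  next
    case (Suc n)
    then obtain v x where "v \<in> words G X n" "x \<in> X" "w = v \<otimes> x" by (auto simp: set_mult_def)
    then show ?case using Suc.IH flip[of v x] words_closed[OF X, of n] \<open>X \<subseteq> P\<close> by auto
  qed
  have cover': "P \<subseteq> words G X (m + 1)"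
  proof
    fix g assume g: "g \<in> P"
    obtain x where x: "x \<in> X" using \<open>X \<noteq> {}\<close> by blast
    have c: "g \<in> carrier G" "x \<in> carrier G" using g x assms X by auto
    have "inv x \<otimes> g \<notin> P"
    proof -
      \<comment> \<open>If \<open>inv x\<close> were even, the identity
        \<open>inv x \<otimes> x\<close> would be odd. So \<open>inv x\<close> is odd, and
        multiplying it by the odd \<open>g\<close> gives an even element, to which
        \<open>cover\<close> applies.\<close>
      have "inv x \<notin> P \<Longrightarrow> inv x \<otimes> x \<in> P" using flip[of "inv x" x] x c \<open>X \<subseteq> P\<close> by auto
      then have "inv x \<in> P" using one c by auto
      then show ?thesis using flip[of "inv x" g] g c by simp
    qed
    then have "inv x \<otimes> g \<in> words G X m" using cover c by auto
    then have "x \<otimes> (inv x \<otimes> g) \<in> words G X (Suc m)" using words_Suc_left[OF X x] by blast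
    moreover have "x \<otimes> (inv x \<otimes> g) = g" using c by (simp add: m_assoc[symmetric])
    ultimately show "g \<in> words G X (m + 1)" by simp
  qed
  have all: "carrier G \<subseteq> (\<Union>n\<le>m + 1. words G X n)"
  proof
    fix g assume "g \<in> carrier G"
    then have "g \<in> words G X m \<or> g \<in> words G X (m + 1)" using cover cover' by blast
    then show "g \<in> (\<Union>n\<le>m + 1. words G X n)"
      by (meson UN_I atMost_iff le_add1 order_refl)
  qed
  have not_all: "\<not> carrier G \<subseteq> (\<Union>n\<le>m. words G X n)"
  proof
    assume *: "carrier G \<subseteq> (\<Union>n\<le>m. words G X n)"
    have "P \<subseteq> (\<Union>n<m. words G X n)"
    proof
      fix g assume g: "g \<in> P"
      then obtain n where n: "n \<le> m" "g \<in> words G X n" using * assms(4) by blast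
      \<comment> \<open>Words of the even length \<open>m\<close> are even, so an odd
        \<open>g\<close> within distance \<open>m\<close> is already within distance
        \<open>m - 1\<close>; this is why \<open>big\<close> sums only over
        \<open>i < m\<close>.\<close>
      then have "n \<noteq> m" using parity[of g n] g \<open>even m\<close> by auto
      then show "g \<in> (\<Union>n<m. words G X n)" using n by force
    qed
    then have "card P \<le> card (\<Union>n<m. words G X n)"
      by (intro card_mono) (auto intro: finite_words[OF finX])
    then show False using card_UN_words_le[OF finX, of m] big by linarith
  qed
  \<comment> \<open>\<open>bipartite_Cayley_orders\<close> ranges over groups on natural numbers, so
    the structure is relabelled along an injection \<open>f\<close>.\<close>
  obtain f :: "'a \<Rightarrow> nat" where f: "inj_on f (carrier G)"
    using finite_imp_inj_to_nat_seg[OF fin] by blast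
  define H where "H = image_group f G"
  have H: "group H" "f \<in> hom G H" and cH: "carrier H = f ` carrier G" and oH: "\<one>\<^bsub>H\<^esub> = f \<one>"
    using inj_imp_image_group_is_group[OF f] inj_imp_image_group_iso[OF f]
    by (auto simp: H_def iso_def image_group_carrier image_group_one)
  interpret H: group H by fact
  have fX: "f ` X \<subseteq> carrier H" using X cH by auto
  have wH: "words H (f ` X) n = f ` words G X n" for n
    using words_hom_image[OF \<open>group G\<close> H X] .
  have sub_iff: "carrier H \<subseteq> (\<Union>n\<le>k. words H (f ` X) n) \<longleftrightarrow> carrier G \<subseteq> (\<Union>n\<le>k. words G X n)" for k
  proof -
    have "(\<Union>n\<le>k. words G X n) \<subseteq> carrier G" using words_closed[OF X] by blast
    then have "f g \<in> f ` (\<Union>n\<le>k. words G X n) \<longleftrightarrow> g \<in> (\<Union>n\<le>k. words G X n)"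
      if "g \<in> carrier G" for g
      using that f by (intro inj_on_image_mem_iff)
    then show ?thesis unfolding wH cH image_UN[symmetric] by (simp only: image_subset_iff subset_iff) blast
  qed
  have diam: "digraph_diameter (Cayley_digraph H (f ` X)) = ereal (real (m + 1))"
    using H.Cayley_diameter_le_iff[OF fX, of "m + 1"] H.Cayley_diameter_ge[OF fX, of m] all not_all
    unfolding sub_iff by (auto intro: antisym)
  have "carrier H \<subseteq> generate H (f ` X)"
    using all H.words_subset_generate unfolding sub_iff[symmetric] by blast
  then have gen: "generate H (f ` X) = carrier H" using H.generate_incl[OF fX] by blast
  have bip: "bipartite_digraph (Cayley_digraph H (f ` X))"
    unfolding bipartite_digraph_def
  proof (intro exI conjI)
    show "f ` P \<union> f ` (carrier G - P) = pverts (Cayley_digraph H (f ` X))"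
      using assms(4) by (auto simp: cH)
    show "f ` P \<inter> f ` (carrier G - P) = {}"
      using assms(4) f by (auto simp: inj_on_def)
    have "f g \<in> f ` P \<and> f g \<otimes>\<^bsub>H\<^esub> f x \<in> f ` (carrier G - P) \<or>
        f g \<in> f ` (carrier G - P) \<and> f g \<otimes>\<^bsub>H\<^esub> f x \<in> f ` P"
      if "g \<in> carrier G" "x \<in> X" for g x
      using that flip[of g x] X \<open>X \<subseteq> P\<close> hom_mult[OF H(2), of g x, symmetric]
      by (cases "g \<in> P") (auto simp: subset_iff)
    then show "\<forall>(u, v)\<in>parcs (Cayley_digraph H (f ` X)).
        u \<in> f ` P \<and> v \<in> f ` (carrier G - P) \<or> u \<in> f ` (carrier G - P) \<and> v \<in> f ` P"
      by (fastforce simp: cH)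
  qed
  have "\<one>\<^bsub>H\<^esub> \<notin> f ` X"
    using one X \<open>X \<subseteq> P\<close> f unfolding oH by (auto simp: inj_on_def)
  moreover have "card (f ` X) = card X" "card (carrier H) = card (carrier G)"
    using f X cH by (auto intro: card_image inj_on_subset)
  moreover have "finite (carrier H)" using fin cH by simp
  ultimately show ?thesis
    using H(1) fX gen bip diam unfolding bipartite_Cayley_orders_def
    by (intro CollectI exI[of _ H] exI[of _ "f ` X"]) simp
qed

section \<open>Lamplighter groups\<close>

text \<open>The wreath product of cyclic groups of orders \<open>q\<close> and \<open>m\<close>,
  times a group of order two given by \<open>bool\<close> under inequality. The lamps of the right
  factor are shifted by the position \<open>i\<close> of the left one. Extensional functions make
  equality of lamp configurations plain equality and keep the carrier finite.\<close>

definition lamp_group :: "nat \<Rightarrow> nat \<Rightarrow> ((int \<Rightarrow> int) \<times> int \<times> bool) monoid" where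
  "lamp_group q m =
    \<lparr> carrier = ({0..<int m} \<rightarrow>\<^sub>E {0..<int q}) \<times> {0..<int m} \<times> UNIV,
      monoid.mult = (\<lambda>(f, i, e) (g, j, e').
        (\<lambda>x\<in>{0..<int m}. (f x + g ((x - i) mod int m)) mod int q, (i + j) mod int m, e \<noteq> e')),
      monoid.one = (\<lambda>x\<in>{0..<int m}. 0, 0, False) \<rparr>"

lemma group_lamp_group:
  assumes "q > 0" "m > 0"
  shows "group (lamp_group q m)"
proof (rule groupI)
  let ?G = "lamp_group q m"
  fix a b c assume a: "a \<in> carrier ?G"
  show "\<exists>b\<in>carrier ?G. b \<otimes>\<^bsub>?G\<^esub> a = \<one>\<^bsub>?G\<^esub>"
  proof -
    obtain f i e where [simp]: "a = (f, i, e)" by (cases a)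
    show ?thesis
      using a assms
      \<comment> \<open>The lamps of the left inverse solve
        \<open>g x + f ((x + i) mod m) = 0\<close> modulo \<open>q\<close>; the parity bit is its
        own inverse.\<close>
      by (intro bexI[of _ "(\<lambda>x\<in>{0..<int m}. (- f ((x + i) mod int m)) mod int q, (- i) mod int m, e)"])
        (auto simp: lamp_group_def mod_simps fun_eq_iff)
  qed
  show "\<one>\<^bsub>?G\<^esub> \<otimes>\<^bsub>?G\<^esub> a = a"
    using a by (auto simp: lamp_group_def fun_eq_iff PiE_def extensional_def Pi_def)
  assume b: "b \<in> carrier ?G"
  show "a \<otimes>\<^bsub>?G\<^esub> b \<in> carrier ?G"
    using a b assms by (auto simp: lamp_group_def)
  assume c: "c \<in> carrier ?G"
  show "a \<otimes>\<^bsub>?G\<^esub> b \<otimes>\<^bsub>?G\<^esub> c = a \<otimes>\<^bsub>?G\<^esub> (b \<otimes>\<^bsub>?G\<^esub> c)"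
    using a b c assms by (auto simp: lamp_group_def mod_simps fun_eq_iff algebra_simps)
qed (use assms in \<open>auto simp: lamp_group_def\<close>)

text \<open>Right multiplication by it adds \<open>h\<close> to the lamp at the current position,
  then moves by \<open>s\<close> and flips the parity. Nothing is reduced here, so it lies in the
  carrier only for reduced \<open>s\<close> and \<open>h\<close>.\<close>

definition lamp_gen :: "nat \<Rightarrow> int \<Rightarrow> int \<Rightarrow> (int \<Rightarrow> int) \<times> int \<times> bool" where
  "lamp_gen m s h = (\<lambda>x\<in>{0..<int m}. if x = 0 then h else 0, s, True)"

text \<open>\<open>P\<close> is an integer lift of the positions on the cycle, so that shifts are
  plain differences. After \<open>n\<close> steps exactly the lamps visited at times below
  \<open>n\<close> have been set to their value in \<open>f\<close>; as no position repeats, each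
  step writes to a lamp that is still zero.\<close>

lemma lamp_group_words:
  assumes gens: "\<And>s h. s \<in> {1, 2} \<Longrightarrow> h \<in> {0..<int q} \<Longrightarrow> lamp_gen m s h \<in> X"
    and f: "f \<in> {0..<int m} \<rightarrow>\<^sub>E {0..<int q}" and "q > 0" "m > 0"
    and "P 0 = (0::int)"
    and step: "\<And>i. i < n \<Longrightarrow> P (Suc i) - P i \<in> {1, 2}"
    and inj: "inj_on (\<lambda>i. P i mod int m) {..<n}"
  shows "(\<lambda>x\<in>{0..<int m}. if x \<in> (\<lambda>i. P i mod int m) ` {..<n} then f x else 0, P n mod int m, odd n)
    \<in> words (lamp_group q m) X n"
  using step inj
proof (induction n)
  case 0
  then show ?case using assms by (simp add: lamp_group_def restrict_def)
next
  case (Suc n)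
  let ?S = "\<lambda>n. (\<lambda>i. P i mod int m) ` {..<n}"
  let ?w = "\<lambda>n. (\<lambda>x\<in>{0..<int m}. if x \<in> ?S n then f x else 0, P n mod int m, odd n)"
  have notin: "P i mod int m \<noteq> P n mod int m" if "i < n" for i
    using inj_onD[OF Suc.prems(2), of i n] that by auto
  have pos: "P n mod int m \<in> {0..<int m}" using \<open>m > 0\<close> by auto
  let ?x = "lamp_gen m (P (Suc n) - P n) (f (P n mod int m))"
  have "?x \<in> X" using gens Suc.prems(1)[of n] f pos by blast
  moreover have "?w n \<in> words (lamp_group q m) X n"
    by (rule Suc.IH) (use Suc.prems in \<open>auto simp: lessThan_Suc\<close>)
  moreover have "?w (Suc n) = ?w n \<otimes>\<^bsub>lamp_group q m\<^esub> ?x"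
  proof -
    have fmod: "f x mod int q = f x" if "0 \<le> x" "x < int m" for x
      using f that by (auto simp: PiE_def Pi_def)
    \<comment> \<open>The next generator touches lamp \<open>x\<close> exactly when \<open>x\<close>
      is the current position.\<close>
    have hit: "int m dvd x - P n \<longleftrightarrow> x = P n mod int m" if "0 \<le> x" "x < int m" for x
      using that by (simp add: mod_eq_dvd_iff[symmetric])
    show ?thesis
      using notin \<open>q > 0\<close> \<open>m > 0\<close>
      by (auto simp: lamp_group_def lamp_gen_def fun_eq_iff fmod hit lessThan_Suc mod_simps dest: notin)
  qed
  ultimately show ?case unfolding words.simps set_mult_def by blast
qed

lemma exists_lamp_path:
  assumes "even m" "m > 0" "j < m"
  obtains P :: "nat \<Rightarrow> int" where "P 0 = 0" "\<And>i. i < m \<Longrightarrow> P (Suc i) - P i \<in> {1, 2}"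
    "inj_on (\<lambda>i. P i mod int m) {..<m}" "P m mod int m = int j"
proof -
  define s where "s = j div 2"
  \<comment> \<open>Evenness of \<open>m\<close> gives the first inequality. It makes the middle
    block of times, \<open>s < i < m - s\<close>, nonempty, so that this block ends at residue
    \<open>m - 1\<close>.\<close>
  have s: "2 * s + 2 \<le> m" "2 * s \<le> j" "j \<le> 2 * s + 1"
    using assms unfolding s_def by presburger+
  \<comment> \<open>The values are 0, 2, ..., \<open>2 * s\<close>, then \<open>2 * s + 1\<close>,
    ..., \<open>m - 1\<close>, then \<open>m + 1\<close>, \<open>m + 3\<close>, ...,
    \<open>m + 2 * s - 1\<close>, and finally \<open>m + j\<close>. The path winds once around the
    cycle; passing \<open>m\<close> costs a shift of 2 when \<open>s > 0\<close>, and when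
    \<open>s = 0\<close> the third block is empty.\<close>
  define P :: "nat \<Rightarrow> int" where
    "P i = (if i \<le> s then 2 * int i else if i + s < m then int s + int i
      else if i < m then int m + 1 + 2 * (int i - (int m - int s)) else int m + int j)" for i
  have Pmod: "P i mod int m = (if i \<le> s then 2 * int i else if i + s < m then int s + int i
      else 1 + 2 * (int i - (int m - int s)))" if "i < m" for i
  proof -
    let ?r = "1 + 2 * (int i - (int m - int s))"
    have "P i mod int m = ?r" if "\<not> i \<le> s" "\<not> i + s < m"
    proof -
      have "P i = ?r + int m" using that \<open>i < m\<close> by (simp add: P_def)
      then have "P i mod int m = ?r mod int m" by (simp only: mod_add_self2)
      also have "\<dots> = ?r" using that \<open>i < m\<close> s by (intro mod_pos_pos_trivial) auto
      finally show ?thesis .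
    qed
    then show ?thesis using that s by (auto simp: P_def)
  qed
  show thesis
  proof (rule that[of P])
    show "P 0 = 0" by (simp add: P_def)
    show "P (Suc i) - P i \<in> {1, 2}" if "i < m" for i
      using that s unfolding P_def by auto
    show "inj_on (\<lambda>i. P i mod int m) {..<m}"
    proof (rule inj_onI)
      fix a b assume ab: "a \<in> {..<m}" "b \<in> {..<m}" "P a mod int m = P b mod int m"
      have cases3: "P i mod int m = 2 * int i \<and> int i \<le> int s
          \<or> P i mod int m = int s + int i \<and> int s < int i \<and> int i + int s < int m
          \<or> P i mod int m = 1 + 2 * (int i - (int m - int s)) \<and> int m \<le> int i + int s \<and> int i < int m"
        if "i \<in> {..<m}" for i
        using Pmod[of i] that s by (cases "i \<le> s"; cases "i + s < m") simp_all
      \<comment> \<open>A version over plain integers, free of \<open>mod\<close>. Residues of the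
        middle block exceed \<open>2 * t\<close>, all others do not, and the first and third blocks
        differ in parity; within a block the residue determines the time.\<close>
      have "x = y" if
        "r = 2 * x \<and> x \<le> t \<or> r = t + x \<and> t < x \<and> x + t < n
          \<or> r = 1 + 2 * (x - (n - t)) \<and> n \<le> x + t \<and> x < n"
        "r = 2 * y \<and> y \<le> t \<or> r = t + y \<and> t < y \<and> y + t < n
          \<or> r = 1 + 2 * (y - (n - t)) \<and> n \<le> y + t \<and> y < n"
        for r x y t n :: int
        using that by (elim disjE conjE) (linarith | presburger)+
      from this[OF cases3[OF ab(1)] cases3[OF ab(2), folded ab(3)]] show "a = b" by simp
    qed
    show "P m mod int m = int j"
      using assms s unfolding P_def by auto
  qed
qed

section \<open>The bound\<close>

text \<open>With \<open>q = d div 2\<close>, the sum is below \<open>d ^ m / (d - 1)\<close>. Here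
  \<open>d ^ m\<close> is at most \<open>3 ^ m * q ^ m\<close>, and the assumption says precisely
  that \<open>3 ^ m\<close> is at most \<open>m * (d - 1)\<close>.\<close>

lemma degree_power_sum_less:
  fixes d m :: nat
  assumes "m \<ge> 4" and "real d \<ge> 3 ^ m / real m + 1"
  shows "(\<Sum>i<m. d ^ i) < m * (d div 2) ^ m"
proof -
  have d1: "d \<ge> 2"
  proof -
    have "3 ^ m / real m > 0" using assms(1) by simp
    then have "real d > 1" using assms(2) by linarith
    then show ?thesis by simp
  qed
  have "3 ^ m \<le> real m * (real d - 1)" using assms by (simp add: field_simps)
  also have "\<dots> = real (m * (d - 1))" using d1 by (simp add: of_nat_diff)
  finally have A: "3 ^ m \<le> m * (d - 1)" by (metis of_nat_le_iff of_nat_numeral of_nat_power)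
  \<comment> \<open>The factor 3 is forced by \<open>d = 3\<close>, where equality holds.\<close>
  have q: "d \<le> 3 * (d div 2)" using d1 by linarith
  have "(d - 1) * (\<Sum>i<m. d ^ i) = d ^ m - 1"
    using d1 by (induction m) (auto simp: algebra_simps diff_mult_distrib)
  also have "\<dots> < d ^ m" using d1 by simp
  also have "\<dots> \<le> (3 * (d div 2)) ^ m" using q by (rule power_mono) simp
  also have "\<dots> = 3 ^ m * (d div 2) ^ m" by (simp add: power_mult_distrib)
  also have "\<dots> \<le> (m * (d - 1)) * (d div 2) ^ m" using A by simp
  finally have "(d - 1) * (\<Sum>i<m. d ^ i) < (d - 1) * (m * (d div 2) ^ m)" by (simp add: ac_simps)
  then show ?thesis by simp
qed

text \<open>The odd class has \<open>m * q ^ m\<close> elements, so \<open>d \<le> m * q ^ m\<close>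
  leaves room to pad the generators to degree \<open>d\<close>. The bound \<open>m \<ge> 3\<close>
  keeps the shift 2 a reduced residue.\<close>

lemma bipartite_Cayley_order_lamp_group:
  assumes "even m" "m \<ge> 3" "q > 0" "2 * q \<le> d"
    and big: "(\<Sum>i<m. d ^ i) < m * q ^ m" and "d \<le> m * q ^ m"
  shows "2 * m * q ^ m \<in> bipartite_Cayley_orders d (m + 1)"
proof -
  define G where "G = lamp_group q m"
  define P where "P = ({0..<int m} \<rightarrow>\<^sub>E {0..<int q}) \<times> {0..<int m} \<times> {True}"
  define A where "A = lamp_gen m 1 ` {0..<int q} \<union> lamp_gen m 2 ` {0..<int q}"
  interpret group G unfolding G_def by (rule group_lamp_group) (use assms in auto)
  have cG: "carrier G = ({0..<int m} \<rightarrow>\<^sub>E {0..<int q}) \<times> {0..<int m} \<times> UNIV"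
    by (simp add: G_def lamp_group_def)
  have finG: "finite (carrier G)" by (simp add: cG finite_PiE)
  have cardP: "card P = m * q ^ m" by (simp add: P_def card_cartesian_product card_PiE)
  have cardG: "card (carrier G) = 2 * m * q ^ m"
    by (simp add: cG card_cartesian_product card_PiE card_UNIV_bool)
  have "m > 0" using assms(2) by simp
  have AP: "A \<subseteq> P"
    using assms by (auto simp: A_def P_def lamp_gen_def)
  have PG: "P \<subseteq> carrier G" by (auto simp: P_def cG)
  have cardA: "card A \<le> d"
    using card_Un_le[of "lamp_gen m 1 ` {0..<int q}" "lamp_gen m 2 ` {0..<int q}"]
      card_image_le[of "{0..<int q}" "lamp_gen m 1"] card_image_le[of "{0..<int q}" "lamp_gen m 2"]
      assms(4) unfolding A_def by simp
  \<comment> \<open>Padding is harmless: words in the lamp generators remain words in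
    \<open>X\<close>, and the criterion otherwise asks only that generators be odd and number
    exactly \<open>d\<close>.\<close>
  obtain X where X: "A \<subseteq> X" "X \<subseteq> P" "card X = d"
    using exists_subset_between[OF cardA _ AP] cardP assms(6) PG finG by (metis finite_subset)
  have "card (carrier G) \<in> bipartite_Cayley_orders (card X) (m + 1)"
  proof (rule bipartite_Cayley_ordersI[OF is_group finG X(2) PG])
    show "\<one>\<^bsub>G\<^esub> \<notin> P" by (auto simp: G_def lamp_group_def P_def)
    show "g \<otimes>\<^bsub>G\<^esub> x \<in> P \<longleftrightarrow> g \<notin> P" if "g \<in> carrier G" "x \<in> P" for g x
      using that m_closed[of g x] PG unfolding cG
      by (auto simp: P_def G_def lamp_group_def)
    show "X \<noteq> {}" using X(3) assms by auto
    show "carrier G - P \<subseteq> words G X m"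
    proof
      fix g assume "g \<in> carrier G - P"
      then obtain f j where g: "g = (f, int j, False)" "j < m" and f: "f \<in> {0..<int m} \<rightarrow>\<^sub>E {0..<int q}"
        by (auto simp: cG P_def) (metis nat_int zless_nat_eq_int_zless nat_0_le)
      obtain p :: "nat \<Rightarrow> int" where p: "p 0 = 0" "\<And>i. i < m \<Longrightarrow> p (Suc i) - p i \<in> {1, 2}"
        "inj_on (\<lambda>i. p i mod int m) {..<m}" "p m mod int m = int j"
        using exists_lamp_path[OF assms(1) \<open>m > 0\<close> g(2)] by blast
      \<comment> \<open>Being \<open>m\<close> distinct residues, the visited positions are all of
        them, so every lamp gets its value in \<open>f\<close>.\<close>
      have "(\<lambda>i. p i mod int m) ` {..<m} = {0..<int m}"
        using p(3) \<open>m > 0\<close> by (intro card_subset_eq) (auto simp: card_image)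
      then have "(\<lambda>x\<in>{0..<int m}. if x \<in> (\<lambda>i. p i mod int m) ` {..<m} then f x else 0) = f"
        using f by (auto simp: fun_eq_iff PiE_def extensional_def)
      moreover have "(\<lambda>x\<in>{0..<int m}. if x \<in> (\<lambda>i. p i mod int m) ` {..<m} then f x else 0,
          p m mod int m, odd m) \<in> words (lamp_group q m) X m"
      proof (rule lamp_group_words[of q m X f p m])
        show "lamp_gen m s h \<in> X" if "s \<in> {1, 2}" "h \<in> {0..<int q}" for s h
          using that X(1) by (auto simp: A_def)
      qed (use f p assms in auto)
      ultimately show "g \<in> words G X m" using p(4) \<open>even m\<close> by (simp add: g G_def)
    qed
  qed (use assms cardP X(3) in auto)
  then show ?thesis using X(3) cardG by simp
qed

theorem mainTheorem13:
  fixes d k :: nat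
  assumes "k \<ge> 5" and "odd k"
    and "real d \<ge> 3 ^ (k - 1) / (real k - 1) + 1"
  shows "BC d k \<ge> 2 * (k - 1) * (d div 2) ^ (k - 1)"
proof -
  define m where "m = k - 1"
  have m: "m \<ge> 4" "even m" "k = m + 1" "real k - 1 = real m" using assms by (auto simp: m_def)
  have big: "(\<Sum>i<m. d ^ i) < m * (d div 2) ^ m"
    using degree_power_sum_less[OF m(1)] assms(3) m by simp
  \<comment> \<open>The single summand \<open>i = 1\<close> already gives
    \<open>d < m * (d div 2) ^ m\<close>, the room needed for padding. Positivity of
    \<open>d div 2\<close> holds because otherwise the right side of \<open>big\<close> would
    vanish.\<close>
  have "d ^ 1 \<le> (\<Sum>i<m. d ^ i)" using m(1) by (intro member_le_sum) auto
  moreover have "d div 2 > 0" using big m(1) by (intro gr0I) (simp add: power_0_left)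
  ultimately have "2 * m * (d div 2) ^ m \<in> bipartite_Cayley_orders d (m + 1)"
    using bipartite_Cayley_order_lamp_group[of m "d div 2" d] m big by auto
  then show ?thesis
    unfolding BC_def m_def[symmetric] m(3)[symmetric] by (intro Max_ge finite_bipartite_Cayley_orders)
qed

end
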